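(* Let $(X,T)$ be a topological dynamical system and let $\Phi=(\varphi_n)_{n\in\mathbb N}$ be an almost additive sequence for $T$ with constant $C>0$. Then, for $i=1,2,3,4$: (1) $PD_i(s,T,\mathbf 0)=D(s,T)$ for every $s>0$. (2) If $s=1$, then $-C+D(s,T)+\inf\varphi_1\le PD_i(s,T,\Phi)\le D(s,T)+\sup\varphi_1+C$. (3) If $s>1$, then $PD_i(s,T,\Phi)=D(s,T)$.
   Context: A topological dynamical system $(X,T)$ (or $(X,d,T)$) is a compact metric space $(X,d)$ with a continuous map $T:X\to X$. A sequence $\Phi=(\varphi_n)_{n\in\mathbb N}$ ($\mathbb N=\{1,2,\dots\}$) of continuous functions $\varphi_n:X\to\mathbb R$ is almost additive for $T$ with constant $C>0$ if $$-C+\varphi_n(x)+\varphi_m(T^n x)\le\varphi_{n+m}(x)\le\varphi_n(x)+\varphi_m(T^n x)+C$$ for all $n,m\in\mathbb N$, $x\in X$. $\mathbf 0$ denotes the sequence with all $\varphi_n\equiv 0$. Let $\mathcal C_X$ be the set of finite open covers of $X$; for $\alpha\in\mathcal C_X$, $\bigvee_{i=0}^{n-1}T^{-i}\alpha=\{A_0\cap T^{-1}A_1\cap\dots\cap T^{-(n-1)}A_{n-1}:A_j\in\alpha\}$. Let $d_n(x,y)=\max_{0\le j<n}d(T^jx,T^jy)$. $F\subseteq X$ is $(n,\epsilon)$-spanning if for each $x\in X$ there is $y\in F$ with $d_n(x,y)<\epsilon$; $E\subseteq X$ is $(n,\epsilon)$-separated if $d_n(x,y)>\epsilon$ for all distinct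 $x,y\in E$. Let $s(n,\epsilon)$ be the minimal cardinality of an $(n,\epsilon)$-spanning set and $r(n,\epsilon)$ the maximal cardinality of an $(n,\epsilon)$-separated set. Put - $q_n(T,\Phi,\alpha)=\inf\{\sum_{B\in\beta}\inf_{x\in B}e^{\varphi_n(x)}:\beta\text{ a finite subcover of }\bigvee_{i=0}^{n-1}T^{-i}\alpha\}$, - $p_n(T,\Phi,\alpha)=\inf\{\sum_{B\in\beta}\sup_{x\in B}e^{\varphi_n(x)}:\beta\text{ a finite subcover of }\bigvee_{i=0}^{n-1}T^{-i}\alpha\}$, - $Q_n(T,\Phi,\epsilon)=\inf\{\sum_{x\in F}e^{\varphi_n(x)}:F\text{ is }(n,\epsilon)\text{-spanning}\}$, - $P_n(T,\Phi,\epsilon)=\sup\{\sum_{x\in E}e^{\varphi_n(x)}:E\text{ is }(n,\epsilon)\text{-separated}\}$. The $s$-topological pressures, with values in $[-\infty,+\infty]$, are $PD_1(s,T,\Phi)=\sup_{\alpha\in\mathcal C_X}\limsup_{n\to\infty}\frac1{n^s}\log q_n(T,\Phi,\alpha)$, $PD_2(s,T,\Phi)=\lim_{\epsilon\to0}\limsup_{n\to\infty}\frac1{n^s}\log Q_n(T,\Phi,\epsilon)$, $PD_3(s,T,\Phi)=\lim_{\epsilon\to0}\limsup_{n\to\infty}\frac1{n^s}\log P_n(T,\Phi,\epsilon)$, $PD_4(s,T,\Phi)=\sup_{\alpha\in\mathcal C_X}\limsup_{n\to\infty}\frac1{n^s}\log p_n(T,\Phi,\alpha)$. The $s$-topological entropy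 is $D(s,T)=\lim_{\epsilon\to0}\limsup_{n\to\infty}\frac1{n^s}\log s(n,\epsilon)=\lim_{\epsilon\to0}\limsup_{n\to\infty}\frac1{n^s}\log r(n,\epsilon)$. *)

theory Defs
  imports "HOL-Analysis.Analysis"
begin

text \<open>
  The space \<open>X\<close> is the carrier of a type of class \<^class>\<open>metric_space\<close> whose universe is compact
  (in particular \<open>X\<close> is nonempty). Sequences indexed by the positive integers are functions on
  \<^typ>\<open>nat\<close> whose value at \<open>0\<close> is never constrained and never matters.
\<close>

definition almost_additive :: "('a::metric_space \<Rightarrow> 'a) \<Rightarrow> (nat \<Rightarrow> 'a \<Rightarrow> real) \<Rightarrow> real \<Rightarrow> bool" where
  "almost_additive T \<phi> C \<longleftrightarrow>
     C > 0 \<and>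
     (\<forall>n\<ge>1. continuous_on UNIV (\<phi> n)) \<and>
     (\<forall>n\<ge>1. \<forall>m\<ge>1. \<forall>x.
        - C + \<phi> n x + \<phi> m ((T ^^ n) x) \<le> \<phi> (n + m) x \<and>
        \<phi> (n + m) x \<le> \<phi> n x + \<phi> m ((T ^^ n) x) + C)"

definition finite_open_covers :: "'a::topological_space set set set" where
  "finite_open_covers = {\<alpha>. finite \<alpha> \<and> (\<forall>A\<in>\<alpha>. open A) \<and> \<Union>\<alpha> = UNIV}"

definition cover_join :: "('a \<Rightarrow> 'a) \<Rightarrow> 'a set set \<Rightarrow> nat \<Rightarrow> 'a set set" where
  "cover_join T \<alpha> n = {\<Inter>i<n. (T ^^ i) -` A i | A. \<forall>i<n. A i \<in> \<alpha>}"

definition finite_subcovers :: "'a set set \<Rightarrow> 'a set set set" where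
  "finite_subcovers \<gamma> = {\<beta>. \<beta> \<subseteq> \<gamma> \<and> finite \<beta> \<and> \<Union>\<beta> = UNIV}"

definition bowen_dist :: "('a::metric_space \<Rightarrow> 'a) \<Rightarrow> nat \<Rightarrow> 'a \<Rightarrow> 'a \<Rightarrow> real" where
  "bowen_dist T n x y = (MAX j\<in>{..<n}. dist ((T ^^ j) x) ((T ^^ j) y))"

definition spanning :: "('a::metric_space \<Rightarrow> 'a) \<Rightarrow> nat \<Rightarrow> real \<Rightarrow> 'a set \<Rightarrow> bool" where
  "spanning T n \<epsilon> F \<longleftrightarrow> (\<forall>x. \<exists>y\<in>F. bowen_dist T n x y < \<epsilon>)"

definition separated :: "('a::metric_space \<Rightarrow> 'a) \<Rightarrow> nat \<Rightarrow> real \<Rightarrow> 'a set \<Rightarrow> bool" where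
  "separated T n \<epsilon> E \<longleftrightarrow> (\<forall>x\<in>E. \<forall>y\<in>E. x \<noteq> y \<longrightarrow> bowen_dist T n x y > \<epsilon>)"

definition min_spanning :: "('a::metric_space \<Rightarrow> 'a) \<Rightarrow> nat \<Rightarrow> real \<Rightarrow> nat" where
  "min_spanning T n \<epsilon> = (LEAST k. \<exists>F. spanning T n \<epsilon> F \<and> finite F \<and> card F = k)"

definition max_separated :: "('a::metric_space \<Rightarrow> 'a) \<Rightarrow> nat \<Rightarrow> real \<Rightarrow> nat" where
  "max_separated T n \<epsilon> = (GREATEST k. \<exists>E. separated T n \<epsilon> E \<and> finite E \<and> card E = k)"

text \<open>
  The quantities below are infima and suprema in \<open>[0,\<infinity>]\<close>. A join may contain the empty set: there
  the infimum is \<open>\<infinity>\<close>, so that no competitive subcover uses it, and the supremum is \<open>0\<close>. Spanning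
  sets may be infinite, so the sums over points are unordered sums in \<open>[0,\<infinity>]\<close>
  (\<^const>\<open>sum\<close> would give \<open>0\<close> on an infinite set).
\<close>

definition q_cover ::
  "('a::metric_space \<Rightarrow> 'a) \<Rightarrow> (nat \<Rightarrow> 'a \<Rightarrow> real) \<Rightarrow> 'a set set \<Rightarrow> nat \<Rightarrow> ennreal" where
  "q_cover T \<phi> \<alpha> n =
     (INF \<beta>\<in>finite_subcovers (cover_join T \<alpha> n). \<Sum>B\<in>\<beta>. INF x\<in>B. ennreal (exp (\<phi> n x)))"

definition p_cover ::
  "('a::metric_space \<Rightarrow> 'a) \<Rightarrow> (nat \<Rightarrow> 'a \<Rightarrow> real) \<Rightarrow> 'a set set \<Rightarrow> nat \<Rightarrow> ennreal" where
  "p_cover T \<phi> \<alpha> n =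
     (INF \<beta>\<in>finite_subcovers (cover_join T \<alpha> n). \<Sum>B\<in>\<beta>. SUP x\<in>B. ennreal (exp (\<phi> n x)))"

definition Q_span ::
  "('a::metric_space \<Rightarrow> 'a) \<Rightarrow> (nat \<Rightarrow> 'a \<Rightarrow> real) \<Rightarrow> real \<Rightarrow> nat \<Rightarrow> ennreal" where
  "Q_span T \<phi> \<epsilon> n = (INF F\<in>{F. spanning T n \<epsilon> F}. \<Sum>\<^sub>\<infinity>x\<in>F. ennreal (exp (\<phi> n x)))"

definition P_sep ::
  "('a::metric_space \<Rightarrow> 'a) \<Rightarrow> (nat \<Rightarrow> 'a \<Rightarrow> real) \<Rightarrow> real \<Rightarrow> nat \<Rightarrow> ennreal" where
  "P_sep T \<phi> \<epsilon> n = (SUP E\<in>{E. separated T n \<epsilon> E}. \<Sum>\<^sub>\<infinity>x\<in>E. ennreal (exp (\<phi> n x)))"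

text \<open>The natural logarithm from \<open>[0,\<infinity>]\<close> to \<open>[-\<infinity>,\<infinity>]\<close>.\<close>

definition elog :: "ennreal \<Rightarrow> ereal" where
  "elog x = (if x = 0 then -\<infinity> else if x = \<infinity> then \<infinity> else ereal (ln (enn2real x)))"

definition growth :: "real \<Rightarrow> (nat \<Rightarrow> ennreal) \<Rightarrow> ereal" where
  "growth s a = limsup (\<lambda>n. ereal (1 / real n powr s) * elog (a n))"

definition PD1 :: "real \<Rightarrow> ('a::metric_space \<Rightarrow> 'a) \<Rightarrow> (nat \<Rightarrow> 'a \<Rightarrow> real) \<Rightarrow> ereal" where
  "PD1 s T \<phi> = (SUP \<alpha>\<in>finite_open_covers. growth s (q_cover T \<phi> \<alpha>))"

definition PD2 :: "real \<Rightarrow> ('a::metric_space \<Rightarrow> 'a) \<Rightarrow> (nat \<Rightarrow> 'a \<Rightarrow> real) \<Rightarrow> ereal" where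
  "PD2 s T \<phi> = Lim (at_right 0) (\<lambda>\<epsilon>. growth s (Q_span T \<phi> \<epsilon>))"

definition PD3 :: "real \<Rightarrow> ('a::metric_space \<Rightarrow> 'a) \<Rightarrow> (nat \<Rightarrow> 'a \<Rightarrow> real) \<Rightarrow> ereal" where
  "PD3 s T \<phi> = Lim (at_right 0) (\<lambda>\<epsilon>. growth s (P_sep T \<phi> \<epsilon>))"

definition PD4 :: "real \<Rightarrow> ('a::metric_space \<Rightarrow> 'a) \<Rightarrow> (nat \<Rightarrow> 'a \<Rightarrow> real) \<Rightarrow> ereal" where
  "PD4 s T \<phi> = (SUP \<alpha>\<in>finite_open_covers. growth s (p_cover T \<phi> \<alpha>))"

text \<open>
  The entropy is defined through spanning sets; the lemma \<open>s_entropy_separated\<close> below shows that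
  separated sets give the same value.
\<close>

definition s_entropy :: "real \<Rightarrow> ('a::metric_space \<Rightarrow> 'a) \<Rightarrow> ereal" where
  "s_entropy s T = Lim (at_right 0) (\<lambda>\<epsilon>. growth s (\<lambda>n. of_nat (min_spanning T n \<epsilon>)))"


text \<open>
  The limits as \<open>\<epsilon>\<close> tends to \<open>0\<close> are limits of monotone functions, hence exist, so that
  \<^const>\<open>Lim\<close> denotes them.
\<close>

lemma antimono_tendsto_at_right_0:
  fixes f :: "real \<Rightarrow> ereal"
  assumes anti: "\<And>\<epsilon> \<delta>. 0 < \<epsilon> \<Longrightarrow> \<epsilon> \<le> \<delta> \<Longrightarrow> f \<delta> \<le> f \<epsilon>"
  shows "(f \<longlongrightarrow> (SUP \<epsilon>\<in>{0<..}. f \<epsilon>)) (at_right 0)"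
proof (rule order_tendstoI)
  fix a assume "a < (SUP \<epsilon>\<in>{0<..}. f \<epsilon>)"
  then obtain \<delta> where \<delta>: "\<delta> > 0" "a < f \<delta>"
    by (auto simp: less_SUP_iff)
  have "\<forall>\<^sub>F \<epsilon> in at_right 0. \<epsilon> \<in> {0<..<\<delta>}"
    using \<delta>(1) by (rule eventually_at_right_real)
  then show "\<forall>\<^sub>F \<epsilon> in at_right 0. a < f \<epsilon>"
    by eventually_elim (use \<delta> anti in \<open>auto intro: less_le_trans\<close>)
next
  fix a assume a: "(SUP \<epsilon>\<in>{0<..}. f \<epsilon>) < a"
  have "\<forall>\<^sub>F \<epsilon> in at_right (0::real). \<epsilon> \<in> {0<..<1}"
    by (rule eventually_at_right_real) simp
  then show "\<forall>\<^sub>F \<epsilon> in at_right 0. f \<epsilon> < a"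
    by eventually_elim (use a in \<open>auto intro: le_less_trans[OF SUP_upper]\<close>)
qed

lemma elog_mono: "x \<le> y \<Longrightarrow> elog x \<le> elog y"
  by (cases x; cases y) (auto simp: elog_def top_unique infinity_ennreal_def ennreal_le_iff)

lemma growth_mono:
  assumes "\<And>n. n \<ge> 1 \<Longrightarrow> a n \<le> b n"
  shows "growth s a \<le> growth s b"
  unfolding growth_def
proof (rule Limsup_mono)
  show "\<forall>\<^sub>F n in sequentially. ereal (1 / real n powr s) * elog (a n) \<le> ereal (1 / real n powr s) * elog (b n)"
    using eventually_ge_at_top[of 1]
    by eventually_elim (intro ereal_mult_left_mono elog_mono assms, auto)
qed

lemma spanning_mono: "spanning T n \<epsilon> F \<Longrightarrow> \<epsilon> \<le> \<delta> \<Longrightarrow> spanning T n \<delta> F"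
  unfolding spanning_def by (meson less_le_trans)

lemma separated_antimono: "separated T n \<delta> E \<Longrightarrow> \<epsilon> \<le> \<delta> \<Longrightarrow> separated T n \<epsilon> E"
  unfolding separated_def by (meson le_less_trans)

lemma Q_span_antimono: "\<epsilon> \<le> \<delta> \<Longrightarrow> Q_span T \<phi> \<delta> n \<le> Q_span T \<phi> \<epsilon> n"
  unfolding Q_span_def by (rule INF_superset_mono) (auto intro: spanning_mono)

lemma P_sep_antimono: "\<epsilon> \<le> \<delta> \<Longrightarrow> P_sep T \<phi> \<delta> n \<le> P_sep T \<phi> \<epsilon> n"
  unfolding P_sep_def by (rule SUP_subset_mono) (auto intro: separated_antimono)

lemma PD2_tendsto: "((\<lambda>\<epsilon>. growth s (Q_span T \<phi> \<epsilon>)) \<longlongrightarrow> PD2 s T \<phi>) (at_right 0)"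
proof -
  have "((\<lambda>\<epsilon>. growth s (Q_span T \<phi> \<epsilon>)) \<longlongrightarrow> (SUP \<epsilon>\<in>{0<..}. growth s (Q_span T \<phi> \<epsilon>))) (at_right 0)"
    by (intro antimono_tendsto_at_right_0 growth_mono Q_span_antimono)
  then show ?thesis
    unfolding PD2_def using tendsto_Lim[OF trivial_limit_at_right_real] by force
qed

lemma PD3_tendsto: "((\<lambda>\<epsilon>. growth s (P_sep T \<phi> \<epsilon>)) \<longlongrightarrow> PD3 s T \<phi>) (at_right 0)"
proof -
  have "((\<lambda>\<epsilon>. growth s (P_sep T \<phi> \<epsilon>)) \<longlongrightarrow> (SUP \<epsilon>\<in>{0<..}. growth s (P_sep T \<phi> \<epsilon>))) (at_right 0)"
    by (intro antimono_tendsto_at_right_0 growth_mono P_sep_antimono)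
  then show ?thesis
    unfolding PD3_def using tendsto_Lim[OF trivial_limit_at_right_real] by force
qed

lemma bowen_dist_less_iff:
  "n \<ge> 1 \<Longrightarrow> bowen_dist T n x y < \<epsilon> \<longleftrightarrow> (\<forall>j<n. dist ((T ^^ j) x) ((T ^^ j) y) < \<epsilon>)"
  unfolding bowen_dist_def by (subst Max_less_iff) (auto simp: lessThan_empty_iff)

lemma bowen_dist_commute: "bowen_dist T n x y = bowen_dist T n y x"
  unfolding bowen_dist_def by (simp add: dist_commute)

context
  fixes T :: "'a::metric_space \<Rightarrow> 'a"
  assumes cpt: "compact (UNIV :: 'a set)" and cont: "continuous_on UNIV T"
begin

lemma continuous_funpow: "continuous_on UNIV (T ^^ j)"
proof (induction j)
  case (Suc j)
  have "continuous_on UNIV (T \<circ> (T ^^ j))"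
    using Suc.IH continuous_on_subset[OF cont] by (intro continuous_on_compose) auto
  then show ?case by simp
qed (simp add: id_def)

lemma finite_spanning_exists:
  assumes "n \<ge> 1" "\<epsilon> > 0"
  shows "\<exists>F. spanning T n \<epsilon> F \<and> finite F"
proof -
  define U where "U y = (\<Inter>j<n. {x. dist ((T ^^ j) x) ((T ^^ j) y) < \<epsilon>})" for y
  have "open (U y)" for y
    unfolding U_def
    by (intro open_INT ballI open_Collect_less continuous_on_dist continuous_on_const continuous_funpow) auto
  moreover have "UNIV \<subseteq> (\<Union>y\<in>UNIV. U y)"
    using assms by (auto simp: U_def)
  ultimately obtain F where "finite F" "UNIV \<subseteq> (\<Union>y\<in>F. U y)"
    using compactE_image[OF cpt, of UNIV U] by metis
  moreover have "bowen_dist T n x y < \<epsilon>" if "x \<in> U y" for x y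
    using that unfolding bowen_dist_less_iff[OF assms(1)] U_def by auto
  ultimately show ?thesis
    unfolding spanning_def by blast
qed

lemma min_spanning_attained:
  assumes "n \<ge> 1" "\<epsilon> > 0"
  shows "\<exists>F. spanning T n \<epsilon> F \<and> finite F \<and> card F = min_spanning T n \<epsilon>"
proof -
  have "\<exists>k F. spanning T n \<epsilon> F \<and> finite F \<and> card F = k"
    using finite_spanning_exists[OF assms] by blast
  from LeastI_ex[OF this] show ?thesis
    unfolding min_spanning_def .
qed

lemma min_spanning_le: "spanning T n \<epsilon> F \<Longrightarrow> finite F \<Longrightarrow> min_spanning T n \<epsilon> \<le> card F"
  unfolding min_spanning_def by (rule Least_le) blast

lemma separated_bound:
  assumes "n \<ge> 1" "\<epsilon> > 0" "separated T n \<epsilon> E"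
  shows "finite E" "card E \<le> min_spanning T n (\<epsilon> / 2)"
proof -
  obtain F where F: "spanning T n (\<epsilon> / 2) F" "finite F" "card F = min_spanning T n (\<epsilon> / 2)"
    using min_spanning_attained[of n "\<epsilon> / 2"] assms by auto
  then obtain f where f: "\<And>x. f x \<in> F" "\<And>x. bowen_dist T n x (f x) < \<epsilon> / 2"
    unfolding spanning_def by metis
  have "inj_on f E"
  proof (rule inj_onI, rule ccontr)
    fix x y assume xy: "x \<in> E" "y \<in> E" "f x = f y" "x \<noteq> y"
    have "bowen_dist T n x y < \<epsilon>"
      unfolding bowen_dist_less_iff[OF assms(1)]
    proof (intro allI impI)
      fix j assume "j < n"
      then have "dist ((T ^^ j) x) ((T ^^ j) (f x)) < \<epsilon> / 2" "dist ((T ^^ j) y) ((T ^^ j) (f x)) < \<epsilon> / 2"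
        using f(2)[of x] f(2)[of y] xy(3) unfolding bowen_dist_less_iff[OF assms(1)] by auto
      then show "dist ((T ^^ j) x) ((T ^^ j) y) < \<epsilon>"
        by (rule dist_triangle_half_l)
    qed
    then show False
      using assms(3) xy unfolding separated_def by fastforce
  qed
  then show "finite E" "card E \<le> min_spanning T n (\<epsilon> / 2)"
    using f(1) F inj_on_finite[of f E F] card_inj_on_le[of f E F] by auto
qed

lemma max_separated_attained:
  assumes "n \<ge> 1" "\<epsilon> > 0"
  shows "\<exists>E. separated T n \<epsilon> E \<and> finite E \<and> card E = max_separated T n \<epsilon>"
proof -
  have "\<exists>k E. separated T n \<epsilon> E \<and> finite E \<and> card E = k"
    by (intro exI[of _ 0] exI[of _ "{}"]) (auto simp: separated_def)
  moreover have "k \<le> min_spanning T n (\<epsilon> / 2)"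
    if "\<exists>E. separated T n \<epsilon> E \<and> finite E \<and> card E = k" for k
    using that separated_bound(2)[OF assms] by blast
  ultimately show ?thesis
    unfolding max_separated_def by (rule GreatestI_ex_nat)
qed

lemma max_separated_ge:
  assumes "n \<ge> 1" "\<epsilon> > 0" "separated T n \<epsilon> E"
  shows "card E \<le> max_separated T n \<epsilon>"
  unfolding max_separated_def
  by (rule Greatest_le_nat[where b = "min_spanning T n (\<epsilon> / 2)"])
     (use assms separated_bound[OF assms(1,2)] in auto)

lemma min_spanning_antimono:
  assumes "n \<ge> 1" "0 < \<epsilon>" "\<epsilon> \<le> \<delta>"
  shows "min_spanning T n \<delta> \<le> min_spanning T n \<epsilon>"
proof -
  obtain F where "spanning T n \<epsilon> F" "finite F" "card F = min_spanning T n \<epsilon>"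
    using min_spanning_attained[OF assms(1,2)] by blast
  then show ?thesis
    using min_spanning_le[of n \<delta> F] spanning_mono[of T n \<epsilon> F \<delta>] assms(3) by simp
qed

lemma max_separated_antimono:
  assumes "n \<ge> 1" "0 < \<epsilon>" "\<epsilon> \<le> \<delta>"
  shows "max_separated T n \<delta> \<le> max_separated T n \<epsilon>"
proof -
  have "\<delta> > 0" using assms by simp
  then obtain E where "separated T n \<delta> E" "card E = max_separated T n \<delta>"
    using max_separated_attained[of n \<delta>] assms(1) by auto
  then show ?thesis
    using max_separated_ge[OF assms(1,2), of E] separated_antimono[of T n \<delta> E \<epsilon>] assms(3) by simp
qed

lemma max_separated_le_min_spanning:
  assumes "n \<ge> 1" "\<epsilon> > 0"
  shows "max_separated T n \<epsilon> \<le> min_spanning T n (\<epsilon> / 2)"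
proof -
  obtain E where "separated T n \<epsilon> E" "card E = max_separated T n \<epsilon>"
    using max_separated_attained[OF assms] by blast
  then show ?thesis
    using separated_bound(2)[OF assms, of E] by simp
qed

lemma min_spanning_le_max_separated:
  assumes "n \<ge> 1" "\<epsilon> > 0"
  shows "min_spanning T n (2 * \<epsilon>) \<le> max_separated T n \<epsilon>"
proof -
  obtain E where E: "separated T n \<epsilon> E" "finite E" "card E = max_separated T n \<epsilon>"
    using max_separated_attained[OF assms] by blast
  have "spanning T n (2 * \<epsilon>) E"
    unfolding spanning_def
  proof (intro allI, rule ccontr)
    fix x assume x: "\<not> (\<exists>y\<in>E. bowen_dist T n x y < 2 * \<epsilon>)"
    then have far: "bowen_dist T n x y > \<epsilon>" if "y \<in> E" for y
    proof -
      have "bowen_dist T n x y \<ge> 2 * \<epsilon>"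
        using x that by (simp add: not_less)
      then show ?thesis using assms(2) by linarith
    qed
    have "bowen_dist T n x x < \<epsilon>"
      using assms by (simp add: bowen_dist_less_iff)
    then have "x \<notin> E"
      using far[of x] by linarith
    moreover have "bowen_dist T n y x > \<epsilon>" if "y \<in> E" for y
      using far[OF that] by (simp add: bowen_dist_commute[of T n y x])
    then have "separated T n \<epsilon> (insert x E)"
      using E(1) far unfolding separated_def by blast
    ultimately show False
      using max_separated_ge[OF assms, of "insert x E"] E by simp
  qed
  then show ?thesis
    using min_spanning_le[OF _ E(2)] E(3) by simp
qed

lemma s_entropy_tendsto:
  "((\<lambda>\<epsilon>. growth s (\<lambda>n. of_nat (min_spanning T n \<epsilon>))) \<longlongrightarrow> s_entropy s T) (at_right 0)"
  and s_entropy_eq_SUP: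
  "s_entropy s T = (SUP \<epsilon>\<in>{0<..}. growth s (\<lambda>n. of_nat (min_spanning T n \<epsilon>)))"
proof -
  have lim: "((\<lambda>\<epsilon>. growth s (\<lambda>n. of_nat (min_spanning T n \<epsilon>))) \<longlongrightarrow>
      (SUP \<epsilon>\<in>{0<..}. growth s (\<lambda>n. of_nat (min_spanning T n \<epsilon>)))) (at_right 0)"
    by (intro antimono_tendsto_at_right_0 growth_mono of_nat_mono min_spanning_antimono)
  then show eq: "s_entropy s T = (SUP \<epsilon>\<in>{0<..}. growth s (\<lambda>n. of_nat (min_spanning T n \<epsilon>)))"
    unfolding s_entropy_def by (intro tendsto_Lim) auto
  show "((\<lambda>\<epsilon>. growth s (\<lambda>n. of_nat (min_spanning T n \<epsilon>))) \<longlongrightarrow> s_entropy s T) (at_right 0)"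
    unfolding eq by (rule lim)
qed

lemma s_entropy_separated:
  "((\<lambda>\<epsilon>. growth s (\<lambda>n. of_nat (max_separated T n \<epsilon>))) \<longlongrightarrow> s_entropy s T) (at_right 0)"
proof -
  have "(SUP \<epsilon>\<in>{0<..}. growth s (\<lambda>n. of_nat (max_separated T n \<epsilon>))) = s_entropy s T"
    unfolding s_entropy_eq_SUP
  proof (intro antisym SUP_mono)
    fix \<epsilon> :: real assume \<epsilon>: "\<epsilon> \<in> {0<..}"
    then show "\<exists>\<delta>\<in>{0<..}. growth s (\<lambda>n. of_nat (max_separated T n \<epsilon>))
        \<le> growth s (\<lambda>n. of_nat (min_spanning T n \<delta>))"
      by (intro bexI[of _ "\<epsilon> / 2"] growth_mono of_nat_mono max_separated_le_min_spanning) auto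
    show "\<exists>\<delta>\<in>{0<..}. growth s (\<lambda>n. of_nat (min_spanning T n \<epsilon>))
        \<le> growth s (\<lambda>n. of_nat (max_separated T n \<delta>))"
      using \<epsilon> min_spanning_le_max_separated[of _ "\<epsilon> / 2"]
      by (intro bexI[of _ "\<epsilon> / 2"] growth_mono of_nat_mono) auto
  qed
  moreover have "((\<lambda>\<epsilon>. growth s (\<lambda>n. of_nat (max_separated T n \<epsilon>))) \<longlongrightarrow>
      (SUP \<epsilon>\<in>{0<..}. growth s (\<lambda>n. of_nat (max_separated T n \<epsilon>)))) (at_right 0)"
    by (intro antimono_tendsto_at_right_0 growth_mono of_nat_mono max_separated_antimono)
  ultimately show ?thesis by simp
qed

end

end

theory Submission
  imports Defs "HOL-Real_Asymp.Real_Asymp"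
begin

text \<open>
  Almost additivity confines \<open>\<phi>\<^sub>n\<close> between \<open>n (inf \<phi>\<^sub>1 - C)\<close> and \<open>n (sup \<phi>\<^sub>1 + C)\<close>. Each of the four
  partition functions is monotone and homogeneous in the weight \<open>exp \<phi>\<^sub>n\<close>, so replacing \<open>\<phi>\<close> by \<open>0\<close>
  changes its logarithm by at most \<open>O(n)\<close>, which is visible at scale \<open>n\<close> and vanishes at scale \<open>n\<^sup>s\<close>
  for \<open>s > 1\<close>. For \<open>\<phi> = 0\<close> the partition functions are cardinalities, and a spanning set is
  traded for a subcover of a join by means of a Lebesgue number, and back by picking a point from
  each nonempty member of the subcover.
\<close>

section \<open>Exponential factors in growth rates, infima, suprema and unordered sums\<close>

lemma elog_exp_mult:
  "elog (ennreal (exp k) * x) = ereal k + elog x"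
proof (cases x)
  case (real r)
  show ?thesis
  proof (cases "r = 0")
    case False
    then have "r > 0" using real by simp
    then have "ennreal (exp k) * x = ennreal (exp k * r)"
      using real by (simp add: ennreal_mult)
    with \<open>r > 0\<close> real show ?thesis
      by (simp add: elog_def ln_mult ennreal_eq_0_iff not_le)
  qed (simp add: real elog_def)
next
  case top
  then show ?thesis
    by (simp add: elog_def ennreal_mult_top)
qed

lemma growth_cong: "(\<And>n. n \<ge> 1 \<Longrightarrow> a n = b n) \<Longrightarrow> growth s a = growth s b"
  by (intro antisym growth_mono) auto

text \<open>The logarithm turns the factor into the summand
  \<open>real n * k / real n powr s\<close>. Its limit \<open>L\<close> is finite, so it splits off
  the limsup exactly. In the application \<open>L\<close> is \<open>k\<close> for
  \<open>s = 1\<close> and 0 for \<open>s > 1\<close>.\<close>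

lemma growth_exp_shift:
  assumes le: "\<And>n. n \<ge> 1 \<Longrightarrow> a n \<le> ennreal (exp (real n * k)) * b n"
    and lim: "(\<lambda>n. real n * k / real n powr s) \<longlonglongrightarrow> L"
  shows "growth s a \<le> ereal L + growth s b"
proof -
  have distrib: "ereal r * (ereal x + y) = ereal (x * r) + ereal r * y" if "r \<ge> 0" for r x y
    using that by (cases y) (auto simp: algebra_simps)
  have "growth s a \<le> growth s (\<lambda>n. ennreal (exp (real n * k)) * b n)"
    by (rule growth_mono) (rule le)
  also have "\<dots> = limsup (\<lambda>n. ereal (real n * k / real n powr s) + ereal (1 / real n powr s) * elog (b n))"
    unfolding growth_def elog_exp_mult by (simp add: distrib)
  also have "\<dots> = ereal L + growth s b"
    unfolding growth_def using lim by (intro ereal_limsup_lim_add) auto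
  finally show ?thesis .
qed

text \<open>For \<open>c > 0\<close> multiplication by \<open>ennreal c\<close> is invertible on all
  of [0,\<infinity>], so the constant can be moved to the left, where \<open>INF_greatest\<close>
  applies. Empty \<open>A\<close> is included, with \<infinity> on both sides; this case arises from
  an empty member of a join.\<close>

lemma INF_le_cmult_INF_ennreal:
  fixes f g :: "'b \<Rightarrow> ennreal"
  assumes "c > 0" "\<And>x. x \<in> A \<Longrightarrow> f x \<le> ennreal c * g x"
  shows "(INF x\<in>A. f x) \<le> ennreal c * (INF x\<in>A. g x)"
proof -
  have inv: "ennreal (1 / c) * (ennreal c * y) = y" "ennreal c * (ennreal (1 / c) * y) = y" for y
    using assms(1) by (simp_all flip: ennreal_mult mult.assoc)
  have "ennreal (1 / c) * (INF x\<in>A. f x) \<le> (INF x\<in>A. g x)"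
  proof (rule INF_greatest)
    fix x assume "x \<in> A"
    then have "(INF x\<in>A. f x) \<le> ennreal c * g x"
      using assms(2) by (meson INF_lower2)
    then have "ennreal (1 / c) * (INF x\<in>A. f x) \<le> ennreal (1 / c) * (ennreal c * g x)"
      by (rule mult_left_mono) simp
    then show "ennreal (1 / c) * (INF x\<in>A. f x) \<le> g x"
      by (simp only: inv)
  qed
  then have "ennreal c * (ennreal (1 / c) * (INF x\<in>A. f x)) \<le> ennreal c * (INF x\<in>A. g x)"
    by (rule mult_left_mono) simp
  then show ?thesis by (simp only: inv)
qed

lemma SUP_le_cmult_SUP_ennreal:
  fixes f g :: "'b \<Rightarrow> ennreal"
  assumes "\<And>x. x \<in> A \<Longrightarrow> f x \<le> c * g x"
  shows "(SUP x\<in>A. f x) \<le> c * (SUP x\<in>A. g x)"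
  unfolding SUP_mult_left_ennreal by (rule SUP_mono) (use assms in blast)

text \<open>Reduces the comparison of possibly infinite sums to finite sums and the supremum rule
  above.\<close>

lemma infsum_eq_SUP_ennreal:
  fixes f :: "'b \<Rightarrow> ennreal"
  shows "infsum f A = (SUP F\<in>{F. finite F \<and> F \<subseteq> A}. sum f F)"
  by (rule nonneg_infsum_complete) simp

lemma infsum_le_cmult_infsum_ennreal:
  fixes f g :: "'b \<Rightarrow> ennreal"
  assumes "\<And>x. x \<in> A \<Longrightarrow> f x \<le> c * g x"
  shows "infsum f A \<le> c * infsum g A"
  unfolding infsum_eq_SUP_ennreal
proof (rule SUP_le_cmult_SUP_ennreal)
  fix F assume "F \<in> {F. finite F \<and> F \<subseteq> A}"
  then show "sum f F \<le> c * sum g F"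
    unfolding sum_distrib_left by (intro sum_mono assms) auto
qed

section \<open>Comparing the pressures of two sequences\<close>

lemma PD2_eq_SUP: "PD2 s T \<phi> = (SUP \<epsilon>\<in>{0<..}. growth s (Q_span T \<phi> \<epsilon>))"
  by (rule tendsto_unique[OF trivial_limit_at_right_real PD2_tendsto])
     (intro antimono_tendsto_at_right_0 growth_mono Q_span_antimono)

lemma PD3_eq_SUP: "PD3 s T \<phi> = (SUP \<epsilon>\<in>{0<..}. growth s (P_sep T \<phi> \<epsilon>))"
  by (rule tendsto_unique[OF trivial_limit_at_right_real PD3_tendsto])
     (intro antimono_tendsto_at_right_0 growth_mono P_sep_antimono)

text \<open>The bound multiplies each weight by at most \<open>exp (real n * k)\<close>, and every
  infimum, supremum and sum in the partition functions passes this factor outward. The lemma is used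
  in both directions, with the zero sequence once as \<phi> and once as \<psi>.\<close>

lemma pressure_shift:
  assumes PD: "PD \<in> {PD1, PD2, PD3, PD4}"
    and le: "\<And>n x. n \<ge> 1 \<Longrightarrow> \<phi> n x \<le> \<psi> n x + real n * k"
    and lim: "(\<lambda>n. real n * k / real n powr s) \<longlonglongrightarrow> L"
  shows "PD s T \<phi> \<le> ereal L + PD s T \<psi>"
proof -
  have weight: "ennreal (exp (\<phi> n x)) \<le> ennreal (exp (real n * k)) * ennreal (exp (\<psi> n x))"
    if "n \<ge> 1" for n x
    using le[OF that, of x] by (simp add: add.commute flip: ennreal_mult exp_add)
  have q: "q_cover T \<phi> \<alpha> n \<le> ennreal (exp (real n * k)) * q_cover T \<psi> \<alpha> n" if "n \<ge> 1" for \<alpha> n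
    unfolding q_cover_def
    by (intro INF_le_cmult_INF_ennreal exp_gt_zero, unfold sum_distrib_left,
        intro sum_mono INF_le_cmult_INF_ennreal exp_gt_zero weight that)
  have p: "p_cover T \<phi> \<alpha> n \<le> ennreal (exp (real n * k)) * p_cover T \<psi> \<alpha> n" if "n \<ge> 1" for \<alpha> n
    unfolding p_cover_def
    by (intro INF_le_cmult_INF_ennreal exp_gt_zero, unfold sum_distrib_left,
        intro sum_mono SUP_le_cmult_SUP_ennreal weight that)
  have Q: "Q_span T \<phi> \<epsilon> n \<le> ennreal (exp (real n * k)) * Q_span T \<psi> \<epsilon> n" if "n \<ge> 1" for \<epsilon> n
    unfolding Q_span_def
    by (intro INF_le_cmult_INF_ennreal exp_gt_zero infsum_le_cmult_infsum_ennreal weight that)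
  have P: "P_sep T \<phi> \<epsilon> n \<le> ennreal (exp (real n * k)) * P_sep T \<psi> \<epsilon> n" if "n \<ge> 1" for \<epsilon> n
    unfolding P_sep_def
    by (intro SUP_le_cmult_SUP_ennreal infsum_le_cmult_infsum_ennreal weight that)
  \<comment> \<open>All four pressures are now suprema of growth rates. The index type stays
    generic: covers for \<open>PD1\<close> and \<open>PD4\<close>, scales for \<open>PD2\<close> and
    \<open>PD3\<close>.\<close>
  have SUP_shift: "(SUP i\<in>I. growth s (a i)) \<le> ereal L + (SUP i\<in>I. growth s (b i))"
    if "\<And>i n. n \<ge> 1 \<Longrightarrow> a i n \<le> ennreal (exp (real n * k)) * b i n"
    for I :: "'i set" and a b
  proof (rule SUP_least)
    fix i assume "i \<in> I"
    have "growth s (a i) \<le> ereal L + growth s (b i)"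
      by (rule growth_exp_shift[OF that lim])
    also have "\<dots> \<le> ereal L + (SUP i\<in>I. growth s (b i))"
      by (intro add_left_mono SUP_upper \<open>i \<in> I\<close>)
    finally show "growth s (a i) \<le> ereal L + (SUP i\<in>I. growth s (b i))" .
  qed
  from PD show ?thesis
    by (elim insertE emptyE; simp only: PD1_def PD2_eq_SUP PD3_eq_SUP PD4_def)
       (intro SUP_shift q p Q P; assumption)+
qed

section \<open>The zero sequence: covers, spanning sets and separated sets\<close>

lemma cover_join_member_bowen_dist:
  assumes "B \<in> cover_join T \<alpha> n" "n \<ge> 1" "x \<in> B" "y \<in> B"
    and small: "\<And>A u v. A \<in> \<alpha> \<Longrightarrow> u \<in> A \<Longrightarrow> v \<in> A \<Longrightarrow> dist u v < \<epsilon>"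
  shows "bowen_dist T n x y < \<epsilon>"
proof -
  obtain A where A: "B = (\<Inter>i<n. (T ^^ i) -` A i)" "\<forall>i<n. A i \<in> \<alpha>"
    using assms(1) unfolding cover_join_def by blast
  show ?thesis
    unfolding bowen_dist_less_iff[OF assms(2)]
  proof (intro allI impI)
    \<comment> \<open>Two points of one member share their itinerary: at time \<open>i\<close> both
      orbits lie in the same small set \<open>A i\<close>.\<close>
    fix i assume "i < n"
    with A assms(3,4) have "A i \<in> \<alpha>" "(T ^^ i) x \<in> A i" "(T ^^ i) y \<in> A i"
      by auto
    then show "dist ((T ^^ i) x) ((T ^^ i) y) < \<epsilon>"
      by (rule small)
  qed
qed

lemma min_spanning_le_p_cover:
  fixes T :: "'a::metric_space \<Rightarrow> 'a"
  assumes "n \<ge> 1" and small: "\<And>A u v. A \<in> \<alpha> \<Longrightarrow> u \<in> A \<Longrightarrow> v \<in> A \<Longrightarrow> dist u v < \<epsilon>"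
    and cpt: "compact (UNIV :: 'a set)" and cont: "continuous_on UNIV T"
  shows "of_nat (min_spanning T n \<epsilon>) \<le> p_cover T (\<lambda>n x. 0) \<alpha> n"
  unfolding p_cover_def
proof (rule INF_greatest)
  fix \<beta> assume "\<beta> \<in> finite_subcovers (cover_join T \<alpha> n)"
  then have \<beta>: "\<beta> \<subseteq> cover_join T \<alpha> n" "finite \<beta>" "\<Union>\<beta> = UNIV"
    unfolding finite_subcovers_def by auto
  define pt where "pt B = (SOME x. x \<in> B)" for B :: "'a set"
  \<comment> \<open>The empty set offers no point to pick. Discarding it is harmless, since its
    supremum adds 0 to the sum.\<close>
  define F where "F = pt ` (\<beta> - {{}})"
  have "spanning T n \<epsilon> F"
    unfolding spanning_def
  proof
    fix x
    obtain B where B: "B \<in> \<beta>" "x \<in> B"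
      using \<beta>(3) by (metis UNIV_I UnionE)
    then have "pt B \<in> B"
      unfolding pt_def by (metis someI)
    with B \<beta>(1) have "bowen_dist T n x (pt B) < \<epsilon>"
      by (intro cover_join_member_bowen_dist[of B T \<alpha>] small assms(1)) auto
    with B show "\<exists>y\<in>F. bowen_dist T n x y < \<epsilon>"
      unfolding F_def by blast
  qed
  then have "min_spanning T n \<epsilon> \<le> card F"
    using min_spanning_le[OF cpt cont] \<beta>(2) F_def by blast
  also have "\<dots> \<le> card (\<beta> - {{}})"
    unfolding F_def using \<beta>(2) by (simp add: card_image_le)
  finally have "of_nat (min_spanning T n \<epsilon>) \<le> (\<Sum>B\<in>\<beta> - {{}}. 1 :: ennreal)"
    by simp
  also have "\<dots> = (\<Sum>B\<in>\<beta> - {{}}. SUP x\<in>B. ennreal (exp 0))"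
    by (intro sum.cong) auto
  also have "\<dots> \<le> (\<Sum>B\<in>\<beta>. SUP x\<in>B. ennreal (exp 0))"
    using \<beta>(2) by (intro sum_mono2) auto
  finally show "of_nat (min_spanning T n \<epsilon>) \<le> (\<Sum>B\<in>\<beta>. SUP x\<in>B. ennreal (exp 0))" .
qed

text \<open>With all weights 1, supremum and infimum agree on a nonempty member. On the empty set
  they are 0 and \<infinity>, which respects this direction.\<close>

lemma p_cover_le_q_cover_zero: "p_cover T (\<lambda>n x. 0) \<alpha> n \<le> q_cover T (\<lambda>n x. 0) \<alpha> n"
  unfolding p_cover_def q_cover_def
proof (intro INF_mono' sum_mono)
  fix B :: "'a set"
  show "(SUP x\<in>B. ennreal (exp 0)) \<le> (INF x\<in>B. ennreal (exp 0))"
    by (cases "B = {}") auto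
qed

context
  fixes T :: "'a::metric_space \<Rightarrow> 'a"
  assumes cpt: "compact (UNIV :: 'a set)" and cont: "continuous_on UNIV T"
begin

text \<open>Here \<epsilon> is a Lebesgue number of \<alpha>. Along the orbit of each point of a
  minimal spanning set, choose members of \<alpha> containing the \<epsilon>-balls; the resulting
  member of the join contains the Bowen ball, so these members cover.\<close>

lemma q_cover_zero_le_min_spanning:
  assumes "\<epsilon> > 0" "n \<ge> 1" and ball: "\<And>x. \<exists>A\<in>\<alpha>. ball x \<epsilon> \<subseteq> A"
  shows "q_cover T (\<lambda>n x. 0) \<alpha> n \<le> of_nat (min_spanning T n \<epsilon>)"
proof -
  obtain F where F: "spanning T n \<epsilon> F" "finite F" "card F = min_spanning T n \<epsilon>"
    using min_spanning_attained[OF cpt cont assms(2,1)] by blast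
  obtain a where a: "\<And>x. a x \<in> \<alpha>" "\<And>x. ball x \<epsilon> \<subseteq> a x"
    using ball by metis
  define B where "B y = (\<Inter>i<n. (T ^^ i) -` a ((T ^^ i) y))" for y
  have mem: "x \<in> B y" if "bowen_dist T n x y < \<epsilon>" for x y
    unfolding B_def
  proof (intro INT_I vimageI2)
    fix i assume "i \<in> {..<n}"
    then have "(T ^^ i) x \<in> ball ((T ^^ i) y) \<epsilon>"
      using that by (simp add: bowen_dist_less_iff[OF assms(2)] dist_commute)
    then show "(T ^^ i) x \<in> a ((T ^^ i) y)"
      using a(2) by blast
  qed
  \<comment> \<open>Nonemptiness matters: an empty \<open>B y\<close> would contribute \<infinity>
    to the sum instead of 1.\<close>
  have "y \<in> B y" for y
    using assms(1,2) by (intro mem) (simp add: bowen_dist_less_iff)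
  then have ne: "B y \<noteq> {}" for y
    by blast
  have "B ` F \<in> finite_subcovers (cover_join T \<alpha> n)"
    unfolding finite_subcovers_def
  proof (intro CollectI conjI)
    show "B ` F \<subseteq> cover_join T \<alpha> n"
    proof (rule image_subsetI)
      fix y
      show "B y \<in> cover_join T \<alpha> n"
        unfolding cover_join_def B_def using a(1)
        by (intro CollectI exI[of _ "\<lambda>i. a ((T ^^ i) y)"]) simp
    qed
    show "\<Union> (B ` F) = UNIV"
      using F(1) mem unfolding spanning_def by blast
  qed (simp add: F)
  then have "q_cover T (\<lambda>n x. 0) \<alpha> n \<le> (\<Sum>b\<in>B ` F. INF x\<in>b. ennreal (exp 0))"
    unfolding q_cover_def by (rule INF_lower)
  also have "\<dots> = (\<Sum>b\<in>B ` F. 1)"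
    by (intro sum.cong) (auto simp: ne)
  \<comment> \<open>Only an inequality, as different points may yield the same
    \<open>B y\<close>.\<close>
  also have "\<dots> \<le> of_nat (card F)"
    using F(2) by (simp add: card_image_le)
  finally show ?thesis using F(3) by simp
qed

lemma Q_span_zero:
  assumes "\<epsilon> > 0" "n \<ge> 1"
  shows "Q_span T (\<lambda>n x. 0) \<epsilon> n = of_nat (min_spanning T n \<epsilon>)"
proof (rule antisym)
  obtain F where F: "spanning T n \<epsilon> F" "finite F" "card F = min_spanning T n \<epsilon>"
    using min_spanning_attained[OF cpt cont assms(2,1)] by blast
  have "Q_span T (\<lambda>n x. 0) \<epsilon> n \<le> (\<Sum>\<^sub>\<infinity>x\<in>F. ennreal (exp 0))"
    unfolding Q_span_def using F(1) by (intro INF_lower) simp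
  with F show "Q_span T (\<lambda>n x. 0) \<epsilon> n \<le> of_nat (min_spanning T n \<epsilon>)"
    by simp
  show "of_nat (min_spanning T n \<epsilon>) \<le> Q_span T (\<lambda>n x. 0) \<epsilon> n"
    unfolding Q_span_def
  proof (rule INF_greatest)
    fix F assume F: "F \<in> {F. spanning T n \<epsilon> F}"
    show "of_nat (min_spanning T n \<epsilon>) \<le> (\<Sum>\<^sub>\<infinity>x\<in>F. ennreal (exp 0))"
    proof (cases "finite F")
      case True
      then show ?thesis
        using F min_spanning_le[OF cpt cont, of n \<epsilon> F] by simp
    next
      \<comment> \<open>An infinite spanning set has total weight \<infinity>, so it cannot undercut
        the minimal cardinality.\<close>
      case False
      then have "(\<Sum>\<^sub>\<infinity>x\<in>F. ennreal (exp 0)) = \<infinity>"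
        by (intro infsum_superconst_infinite_ennreal[where b = 1]) auto
      then show ?thesis by simp
    qed
  qed
qed

lemma P_sep_zero:
  assumes "\<epsilon> > 0" "n \<ge> 1"
  shows "P_sep T (\<lambda>n x. 0) \<epsilon> n = of_nat (max_separated T n \<epsilon>)"
proof (rule antisym)
  show "P_sep T (\<lambda>n x. 0) \<epsilon> n \<le> of_nat (max_separated T n \<epsilon>)"
    unfolding P_sep_def
  proof (rule SUP_least)
    fix E assume "E \<in> {E. separated T n \<epsilon> E}"
    then show "(\<Sum>\<^sub>\<infinity>x\<in>E. ennreal (exp 0)) \<le> of_nat (max_separated T n \<epsilon>)"
      using separated_bound(1)[OF cpt cont assms(2,1)] max_separated_ge[OF cpt cont assms(2,1)]
      by simp
  qed
  obtain E where E: "separated T n \<epsilon> E" "finite E" "card E = max_separated T n \<epsilon>"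
    using max_separated_attained[OF cpt cont assms(2,1)] by blast
  then have "of_nat (max_separated T n \<epsilon>) = (\<Sum>\<^sub>\<infinity>x\<in>E. ennreal (exp 0))"
    by simp
  also have "\<dots> \<le> P_sep T (\<lambda>n x. 0) \<epsilon> n"
    unfolding P_sep_def using E(1) by (intro SUP_upper) simp
  finally show "of_nat (max_separated T n \<epsilon>) \<le> P_sep T (\<lambda>n x. 0) \<epsilon> n" .
qed

lemma PD2_zero: "PD2 s T (\<lambda>n x. 0) = s_entropy s T"
  unfolding PD2_eq_SUP s_entropy_eq_SUP[OF cpt cont]
  by (intro SUP_cong refl growth_cong Q_span_zero) auto

text \<open>Here the partition function counts separated sets, while the entropy is defined by
  spanning sets; \<open>s_entropy_separated\<close> and uniqueness of limits bridge the two.\<close>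

lemma PD3_zero: "PD3 s T (\<lambda>n x. 0) = s_entropy s T"
proof (rule tendsto_unique[OF trivial_limit_at_right_real PD3_tendsto])
  have "\<forall>\<^sub>F \<epsilon> in at_right 0. growth s (\<lambda>n. of_nat (max_separated T n \<epsilon>)) = growth s (P_sep T (\<lambda>n x. 0) \<epsilon>)"
    using eventually_at_right_less[of "0::real"]
    by eventually_elim (intro growth_cong P_sep_zero[symmetric])
  then show "((\<lambda>\<epsilon>. growth s (P_sep T (\<lambda>n x. 0) \<epsilon>)) \<longlongrightarrow> s_entropy s T) (at_right 0)"
    by (rule Lim_transform_eventually[OF s_entropy_separated[OF cpt cont]])
qed

lemma finite_cover_of_small_sets:
  assumes "\<epsilon> > 0"
  obtains \<alpha> :: "'a set set"
  where "\<alpha> \<in> finite_open_covers" "\<And>A u v. A \<in> \<alpha> \<Longrightarrow> u \<in> A \<Longrightarrow> v \<in> A \<Longrightarrow> dist u v < \<epsilon>"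
proof -
  have "UNIV \<subseteq> (\<Union>y::'a\<in>UNIV. ball y (\<epsilon> / 2))"
    using assms by auto
  then obtain F :: "'a set" where F: "finite F" "UNIV \<subseteq> (\<Union>y\<in>F. ball y (\<epsilon> / 2))"
    using compactE_image[OF cpt, of UNIV "\<lambda>y. ball y (\<epsilon> / 2)"] by (metis open_ball)
  show thesis
  proof
    show "(\<lambda>y. ball y (\<epsilon> / 2)) ` F \<in> finite_open_covers"
      using F unfolding finite_open_covers_def by auto
    fix A u v assume "A \<in> (\<lambda>y. ball y (\<epsilon> / 2)) ` F" "u \<in> A" "v \<in> A"
    then show "dist u v < \<epsilon>"
      by (auto intro: dist_triangle_half_r)
  qed
qed

lemma finite_open_cover_Lebesgue_number:
  assumes "\<alpha> \<in> (finite_open_covers :: 'a set set set)"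
  obtains \<epsilon> where "\<epsilon> > 0" "\<And>x. \<exists>A\<in>\<alpha>. ball x \<epsilon> \<subseteq> A"
  using Heine_Borel_lemma[OF cpt, of \<alpha>] assms unfolding finite_open_covers_def
  by (metis (mono_tags, lifting) UNIV_I mem_Collect_eq subset_refl)

text \<open>The inequalities close a cycle: entropy \<le> \<open>PD4\<close> by a cover finer than
  the scale, \<open>PD4\<close> \<le> \<open>PD1\<close> by comparing terms, and \<open>PD1\<close>
  \<le> entropy by a scale that is a Lebesgue number of the cover.\<close>

lemma PD1_PD4_zero:
  "PD1 s T (\<lambda>n x. 0) = s_entropy s T" "PD4 s T (\<lambda>n x. 0) = s_entropy s T"
proof -
  have "s_entropy s T \<le> PD4 s T (\<lambda>n x. 0)"
    unfolding s_entropy_eq_SUP[OF cpt cont] PD4_def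
  proof (rule SUP_mono)
    fix \<epsilon> :: real assume "\<epsilon> \<in> {0<..}"
    then obtain \<alpha> :: "'a set set" where \<alpha>: "\<alpha> \<in> finite_open_covers"
      "\<And>A u v. A \<in> \<alpha> \<Longrightarrow> u \<in> A \<Longrightarrow> v \<in> A \<Longrightarrow> dist u v < \<epsilon>"
      using finite_cover_of_small_sets by (metis greaterThan_iff)
    then show "\<exists>\<alpha>\<in>finite_open_covers. growth s (\<lambda>n. of_nat (min_spanning T n \<epsilon>))
        \<le> growth s (p_cover T (\<lambda>n x. 0) \<alpha>)"
      by (intro bexI[of _ \<alpha>] growth_mono min_spanning_le_p_cover cpt cont)
  qed
  moreover have "PD4 s T (\<lambda>n x. 0) \<le> PD1 s T (\<lambda>n x. 0)"
    unfolding PD1_def PD4_def by (intro SUP_mono' growth_mono p_cover_le_q_cover_zero)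
  moreover have "PD1 s T (\<lambda>n x. 0) \<le> s_entropy s T"
    unfolding s_entropy_eq_SUP[OF cpt cont] PD1_def
  proof (rule SUP_mono)
    fix \<alpha> :: "'a set set" assume "\<alpha> \<in> finite_open_covers"
    then obtain \<epsilon> where "\<epsilon> > 0" "\<And>x. \<exists>A\<in>\<alpha>. ball x \<epsilon> \<subseteq> A"
      using finite_open_cover_Lebesgue_number by metis
    then show "\<exists>\<epsilon>\<in>{0<..}. growth s (q_cover T (\<lambda>n x. 0) \<alpha>)
        \<le> growth s (\<lambda>n. of_nat (min_spanning T n \<epsilon>))"
      by (intro bexI[of _ \<epsilon>] growth_mono q_cover_zero_le_min_spanning) auto
  qed
  ultimately show "PD1 s T (\<lambda>n x. 0) = s_entropy s T" "PD4 s T (\<lambda>n x. 0) = s_entropy s T"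
    by (auto intro: antisym order_trans)
qed

end

section \<open>Linear bounds from almost additivity, and the conclusion\<close>

lemma almost_additive_linear_bounds:
  assumes aa: "almost_additive T \<phi> C" and "n \<ge> 1"
    and m: "\<And>x. m \<le> \<phi> 1 x" and M: "\<And>x. \<phi> 1 x \<le> M"
  shows "real n * (m - C) \<le> \<phi> n x" "\<phi> n x \<le> real n * (M + C)"
proof -
  have C: "C > 0"
    using aa unfolding almost_additive_def by blast
  have additive: "- C + \<phi> n x + \<phi> 1 ((T ^^ n) x) \<le> \<phi> (Suc n) x"
    "\<phi> (Suc n) x \<le> \<phi> n x + \<phi> 1 ((T ^^ n) x) + C" if "n \<ge> 1" for n
    using aa that unfolding almost_additive_def Suc_eq_plus1 by blast+
  have "real n * (m - C) \<le> \<phi> n x \<and> \<phi> n x \<le> real n * (M + C)"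
    using \<open>n \<ge> 1\<close>
  proof (induction n rule: dec_induct)
    \<comment> \<open>Reaching \<open>n\<close> takes only \<open>n - 1\<close> splittings, each
      costing \<open>C\<close>. The bound allows \<open>n\<close> copies, so the base case rests on
      \<open>C > 0\<close>.\<close>
    case base
    show ?case using m[of x] M[of x] C by auto
  next
    case (step n)
    then show ?case
      using additive[of n] m[of "(T ^^ n) x"] M[of "(T ^^ n) x"]
      by (simp add: algebra_simps)
  qed
  then show "real n * (m - C) \<le> \<phi> n x" "\<phi> n x \<le> real n * (M + C)"
    by auto
qed

theorem theorem3p1:
  fixes T :: "'a::metric_space \<Rightarrow> 'a"
    and \<phi> :: "nat \<Rightarrow> 'a \<Rightarrow> real"
    and C :: real
  assumes "compact (UNIV :: 'a set)"
    and "continuous_on UNIV T"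
    and "almost_additive T \<phi> C"
  shows "\<forall>PD \<in> {PD1, PD2, PD3, PD4}.
      (\<forall>s>0. PD s T (\<lambda>n x. 0) = s_entropy s T) \<and>
      (ereal (- C) + s_entropy 1 T + (INF x. ereal (\<phi> 1 x)) \<le> PD 1 T \<phi> \<and>
       PD 1 T \<phi> \<le> s_entropy 1 T + (SUP x. ereal (\<phi> 1 x)) + ereal C) \<and>
      (\<forall>s>1. PD s T \<phi> = s_entropy s T)"
proof
  fix PD :: "real \<Rightarrow> ('a \<Rightarrow> 'a) \<Rightarrow> (nat \<Rightarrow> 'a \<Rightarrow> real) \<Rightarrow> ereal"
  assume PD: "PD \<in> {PD1, PD2, PD3, PD4}"
  then have zero: "PD s T (\<lambda>n x. 0) = s_entropy s T" for s
    using PD1_PD4_zero[OF assms(1,2)] PD2_zero[OF assms(1,2)] PD3_zero[OF assms(1,2)] by auto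
  have cont1: "continuous_on UNIV (\<phi> 1)"
    using assms(3) unfolding almost_additive_def by blast
  \<comment> \<open>By compactness the extrema of \<open>\<phi> 1\<close> are attained, so both are
    real numbers and \<open>pressure_shift\<close> accepts them as constants.\<close>
  obtain u where u: "\<And>x. \<phi> 1 u \<le> \<phi> 1 x"
    using continuous_attains_inf[OF assms(1) _ cont1] by auto
  obtain v where v: "\<And>x. \<phi> 1 x \<le> \<phi> 1 v"
    using continuous_attains_sup[OF assms(1) _ cont1] by auto
  have INF_eq: "(INF x. ereal (\<phi> 1 x)) = ereal (\<phi> 1 u)"
    using u by (intro antisym INF_lower INF_greatest) auto
  have SUP_eq: "(SUP x. ereal (\<phi> 1 x)) = ereal (\<phi> 1 v)"
    using v by (intro antisym SUP_upper SUP_least) auto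
  note bounds = almost_additive_linear_bounds[OF assms(3) _ u v]
  \<comment> \<open>The lower bound on \<phi> reads
    \<open>0 \<le> \<phi> n x + real n * (C - \<phi> 1 u)\<close>, so the zero sequence is the one
    being dominated.\<close>
  have lower: "s_entropy s T \<le> ereal L + PD s T \<phi>"
    if "(\<lambda>n. real n * (C - \<phi> 1 u) / real n powr s) \<longlonglongrightarrow> L" for s L
    unfolding zero[symmetric]
    by (rule pressure_shift[OF PD _ that]) (use bounds(1) in \<open>simp add: algebra_simps\<close>)
  have upper: "PD s T \<phi> \<le> ereal L + s_entropy s T"
    if "(\<lambda>n. real n * (\<phi> 1 v + C) / real n powr s) \<longlonglongrightarrow> L" for s L
    unfolding zero[symmetric]
    by (rule pressure_shift[OF PD _ that]) (use bounds(2) in simp)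
  have lim1: "(\<lambda>n. real n * k / real n powr 1) \<longlonglongrightarrow> k" for k
    by real_asymp
  have lim0: "(\<lambda>n. real n * k / real n powr s) \<longlonglongrightarrow> 0" if "s > 1" for s k :: real
    using that by real_asymp
  \<comment> \<open>Entropy and pressure may be infinite, so the real summand is moved across the
    inequality by cases.\<close>
  have "ereal (- C) + s_entropy 1 T + ereal (\<phi> 1 u) \<le> PD 1 T \<phi>"
    using lower[OF lim1] by (cases "s_entropy 1 T"; cases "PD 1 T \<phi>") auto
  moreover have "PD 1 T \<phi> \<le> s_entropy 1 T + ereal (\<phi> 1 v) + ereal C"
    using upper[OF lim1] by (cases "s_entropy 1 T"; cases "PD 1 T \<phi>") auto
  moreover have "PD s T \<phi> = s_entropy s T" if "s > 1" for s
    using lower[OF lim0[OF that]] upper[OF lim0[OF that]] by (simp add: zero_ereal_def[symmetric])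
  ultimately show "(\<forall>s>0. PD s T (\<lambda>n x. 0) = s_entropy s T) \<and>
      (ereal (- C) + s_entropy 1 T + (INF x. ereal (\<phi> 1 x)) \<le> PD 1 T \<phi> \<and>
       PD 1 T \<phi> \<le> s_entropy 1 T + (SUP x. ereal (\<phi> 1 x)) + ereal C) \<and>
      (\<forall>s>1. PD s T \<phi> = s_entropy s T)"
    unfolding INF_eq SUP_eq by (simp add: zero)
qed

end
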